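(* Let $\lambda$ and $\mu$ be infinite cardinals and let $D$ be a $(\mu,\lambda)$-regular ultrafilter (over some set). If $X$ is a $D$-pseudocompact topological space, then $X$ is $\mathcal O$-$[\mu,\lambda]$-compact. More generally, if $(X_j)_{j\in J}$ is a sequence of $D$-pseudocompact topological spaces, then the Tychonoff product $\prod_{j\in J}X_j$ is $\mathcal O$-$[\mu,\lambda]$-compact.
   Context: No separation axiom is assumed. $S_\mu(\lambda)$ denotes the set of all subsets of $\lambda$ of cardinality $<\mu$. "Sequence" means an indexed family (repetitions allowed). A topological space $X$ is $\mathcal O$-$[\mu,\lambda]$-compact if for every sequence $(C_\alpha)_{\alpha\in\lambda}$ of closed sets of $X$ the following holds: if for every $Z\subseteq\lambda$ with $|Z|<\mu$ there exists a nonempty open set $O_Z$ of $X$ such that $\bigcap_{\alpha\in Z}C_\alpha\supseteq O_Z$, then $\bigcap_{\alpha\in\lambda}C_\alpha\neq\emptyset$ (the intersection over $Z=\emptyset$ is the whole space). If $D$ is an ultrafilter over a set $I$ and $(Y_i)_{i\in I}$ is a sequence of subsets of $X$, a point $x\in X$ is a $D$-limit point of $(Y_i)_{i\in I}$ if $\{i\in I\mid Y_i\cap U\neq\emptyset\}\in D$ for every neighborhood $U$ of $x$ in $X$. The space $X$ is $D$-pseudocompact if every sequence $(O_i)_{i\in I}$ of nonempty open subsets of $X$ has some $D$-limit point in $X$. An ultrafilter $D$ over a set $I$ is $(\mu,\lambda)$-regular if there is a function $f:I\to S_\mu(\lambda)$ such that $\{i\in I\mid\alpha\in f(i)\}\in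 D$ for every $\alpha\in\lambda$. *)

theory Defs
  imports "HOL-Analysis.Analysis"
begin

unbundle cardinal_syntax

text \<open>
  A cardinal is a cardinal order in the sense of the library, i.e. a relation \<open>r\<close> with
  \<open>Card_order r\<close>; the set of its elements is \<open>Field r\<close>, and \<open>\<alpha> \<in> r\<close> on paper
  becomes \<open>\<alpha> \<in> Field r\<close>. The cardinals \<open>\<mu>\<close> and \<open>\<lambda>\<close> may live on different types.
\<close>

definition small_subsets :: "'m rel \<Rightarrow> 'l rel \<Rightarrow> 'l set set" where
  "small_subsets \<mu> \<Lambda> = {Z. Z \<subseteq> Field \<Lambda> \<and> |Z| <o \<mu>}"

text \<open>
  The intersection of the empty family must be the whole space, hence the explicit
  \<open>topspace X\<close>.
\<close>

definition O_compact :: "'m rel \<Rightarrow> 'l rel \<Rightarrow> 'a topology \<Rightarrow> bool" where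
  "O_compact \<mu> \<Lambda> X \<longleftrightarrow>
    (\<forall>C :: 'l \<Rightarrow> 'a set.
      (\<forall>\<alpha>\<in>Field \<Lambda>. closedin X (C \<alpha>)) \<longrightarrow>
      (\<forall>Z\<in>small_subsets \<mu> \<Lambda>.
         \<exists>U. openin X U \<and> U \<noteq> {} \<and> U \<subseteq> topspace X \<inter> (\<Inter>\<alpha>\<in>Z. C \<alpha>)) \<longrightarrow>
      topspace X \<inter> (\<Inter>\<alpha>\<in>Field \<Lambda>. C \<alpha>) \<noteq> {})"

text \<open>
  An ultrafilter over a set \<open>I\<close> is given as a library filter \<open>D\<close> on the ambient type that
  contains \<open>I\<close>; for \<open>A \<subseteq> I\<close>, the membership \<open>A \<in> D\<close> is
  \<open>eventually (\<lambda>i. i \<in> A) D\<close>.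
\<close>

definition ultrafilter_over :: "'i set \<Rightarrow> 'i filter \<Rightarrow> bool" where
  "ultrafilter_over I D \<longleftrightarrow>
    eventually (\<lambda>i. i \<in> I) D \<and> D \<noteq> bot \<and>
    (\<forall>A\<subseteq>I. eventually (\<lambda>i. i \<in> A) D \<or> eventually (\<lambda>i. i \<in> I - A) D)"

definition regular_ultrafilter :: "'m rel \<Rightarrow> 'l rel \<Rightarrow> 'i set \<Rightarrow> 'i filter \<Rightarrow> bool" where
  "regular_ultrafilter \<mu> \<Lambda> I D \<longleftrightarrow>
    ultrafilter_over I D \<and>
    (\<exists>f \<in> I \<rightarrow> small_subsets \<mu> \<Lambda>.
       \<forall>\<alpha>\<in>Field \<Lambda>. eventually (\<lambda>i. i \<in> {i \<in> I. \<alpha> \<in> f i}) D)"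

definition neighbourhood :: "'a topology \<Rightarrow> 'a \<Rightarrow> 'a set \<Rightarrow> bool" where
  "neighbourhood X x U \<longleftrightarrow>
    U \<subseteq> topspace X \<and> (\<exists>V. openin X V \<and> x \<in> V \<and> V \<subseteq> U)"

definition D_limit_point ::
    "'i set \<Rightarrow> 'i filter \<Rightarrow> 'a topology \<Rightarrow> ('i \<Rightarrow> 'a set) \<Rightarrow> 'a \<Rightarrow> bool" where
  "D_limit_point I D X Y x \<longleftrightarrow>
    x \<in> topspace X \<and>
    (\<forall>U. neighbourhood X x U \<longrightarrow> eventually (\<lambda>i. i \<in> {i \<in> I. Y i \<inter> U \<noteq> {}}) D)"

definition D_pseudocompact :: "'i set \<Rightarrow> 'i filter \<Rightarrow> 'a topology \<Rightarrow> bool" where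
  "D_pseudocompact I D X \<longleftrightarrow>
    (\<forall>Y :: 'i \<Rightarrow> 'a set.
      (\<forall>i\<in>I. openin X (Y i) \<and> Y i \<noteq> {}) \<longrightarrow> (\<exists>x. D_limit_point I D X Y x))"

end

theory Submission
  imports Defs
begin

text \<open>
  Regularity turns an index \<open>i\<close> into a small subset \<open>f i\<close> of \<open>\<Lambda>\<close>. If the closed sets
  \<open>C \<alpha>\<close> satisfy the hypothesis of \<open>\<O>\<close>-compactness, some nonempty open set \<open>Y i\<close> lies in all
  the \<open>C \<alpha>\<close> with \<open>\<alpha> \<in> f i\<close>, and a \<open>D\<close>-limit point of the family \<open>Y\<close> lies in every
  \<open>C \<alpha>\<close>: for \<open>D\<close>-almost all \<open>i\<close> the set \<open>Y i\<close> is contained in \<open>C \<alpha>\<close>, so \<open>Y\<close> cannot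
  accumulate at a point of the open complement of \<open>C \<alpha>\<close>
  (\<open>D_pseudocompact_imp_O_compact\<close>).

  The product case reduces to this one because, like compactness along a fixed ultrafilter,
  \<open>D\<close>-pseudocompactness is productive (\<open>D_pseudocompact_product\<close>). Limit points of open sets
  can be found coordinatewise: nonempty open subsets of the product are shrunk to boxes, and
  since a basic neighbourhood in the product restricts only finitely many coordinates, the
  coordinatewise conditions hold simultaneously for \<open>D\<close>-almost all \<open>i\<close>.
\<close>

lemma D_limit_pointD:
  assumes "D_limit_point I D X Y x" "openin X U" "x \<in> U"
  shows "eventually (\<lambda>i. i \<in> I \<and> Y i \<inter> U \<noteq> {}) D"
proof -
  have "neighbourhood X x U"
    using assms(2,3) openin_subset unfolding neighbourhood_def by blast
  then show ?thesis
    using assms(1) unfolding D_limit_point_def by simp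
qed

theorem D_pseudocompact_imp_O_compact:
  fixes \<Lambda> :: "'l rel" and X :: "'a topology"
  assumes reg: "regular_ultrafilter \<mu> \<Lambda> I D" and pc: "D_pseudocompact I D X"
  shows "O_compact \<mu> \<Lambda> X"
  unfolding O_compact_def
proof (intro allI impI)
  fix C :: "'l \<Rightarrow> 'a set"
  assume closed: "\<forall>\<alpha>\<in>Field \<Lambda>. closedin X (C \<alpha>)"
    and small: "\<forall>Z\<in>small_subsets \<mu> \<Lambda>.
      \<exists>U. openin X U \<and> U \<noteq> {} \<and> U \<subseteq> topspace X \<inter> (\<Inter>\<alpha>\<in>Z. C \<alpha>)"
  have nontriv: "D \<noteq> bot"
    using reg unfolding regular_ultrafilter_def ultrafilter_over_def by blast
  obtain f where f: "f \<in> I \<rightarrow> small_subsets \<mu> \<Lambda>"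
    and f_ev: "\<And>\<alpha>. \<alpha> \<in> Field \<Lambda> \<Longrightarrow> eventually (\<lambda>i. i \<in> {i \<in> I. \<alpha> \<in> f i}) D"
    using reg unfolding regular_ultrafilter_def by blast
  have "\<forall>i\<in>I. \<exists>U. openin X U \<and> U \<noteq> {} \<and> U \<subseteq> topspace X \<inter> (\<Inter>\<alpha>\<in>f i. C \<alpha>)"
    using small funcset_mem[OF f] by simp
  from bchoice[OF this] obtain Y where
    Y_all: "\<forall>i\<in>I. openin X (Y i) \<and> Y i \<noteq> {} \<and> Y i \<subseteq> topspace X \<inter> (\<Inter>\<alpha>\<in>f i. C \<alpha>)"
    by blast
  then have Y: "\<forall>i\<in>I. openin X (Y i) \<and> Y i \<noteq> {}"
    and Y_sub: "\<And>i \<alpha>. i \<in> I \<Longrightarrow> \<alpha> \<in> f i \<Longrightarrow> Y i \<subseteq> C \<alpha>"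
    by auto
  obtain x where x: "D_limit_point I D X Y x"
    using pc Y unfolding D_pseudocompact_def by blast
  have x_in: "x \<in> topspace X"
    using x unfolding D_limit_point_def by blast
  have "x \<in> C \<alpha>" if \<alpha>: "\<alpha> \<in> Field \<Lambda>" for \<alpha>
  proof (rule ccontr)
    assume "x \<notin> C \<alpha>"
    moreover have "openin X (topspace X - C \<alpha>)"
      using closed \<alpha> by blast
    ultimately have "eventually (\<lambda>i. i \<in> I \<and> Y i \<inter> (topspace X - C \<alpha>) \<noteq> {}) D"
      using D_limit_pointD[OF x] x_in by blast
    with f_ev[OF \<alpha>] have "eventually (\<lambda>i. False) D"
      by eventually_elim (use Y_sub in blast)
    then show False
      using nontriv by (simp add: trivial_limit_def)
  qed
  then show "topspace X \<inter> (\<Inter>\<alpha>\<in>Field \<Lambda>. C \<alpha>) \<noteq> {}"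
    using x_in by blast
qed

lemma openin_product_topology_boxE:
  assumes "openin (product_topology X J) S" "p \<in> S"
  obtains W where "finite {j \<in> J. W j \<noteq> topspace (X j)}" "\<forall>j\<in>J. openin (X j) (W j)"
    "p \<in> Pi\<^sub>E J W" "Pi\<^sub>E J W \<subseteq> S"
  using bspec[OF iffD1[OF openin_product_topology_alt assms(1)] assms(2)] by (elim exE conjE) rule

text \<open>
  The limit point is assembled from limit points in the factors. A box around it meets a box of
  the family as soon as their sides meet in the finitely many coordinates restricted by the
  former; in the other coordinates nonemptiness of the sides suffices.
\<close>

theorem D_pseudocompact_product:
  fixes I :: "'i set" and X :: "'j \<Rightarrow> 'b topology"
  assumes pc: "\<forall>j\<in>J. D_pseudocompact I D (X j)" and I_ev: "eventually (\<lambda>i. i \<in> I) D"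
  shows "D_pseudocompact I D (product_topology X J)"
  unfolding D_pseudocompact_def
proof (intro allI impI)
  fix Y :: "'i \<Rightarrow> ('j \<Rightarrow> 'b) set"
  assume Y: "\<forall>i\<in>I. openin (product_topology X J) (Y i) \<and> Y i \<noteq> {}"
  have "\<exists>W. (\<forall>j\<in>J. openin (X j) (W j) \<and> W j \<noteq> {}) \<and> Pi\<^sub>E J W \<subseteq> Y i"
    if i: "i \<in> I" for i
  proof -
    have "openin (product_topology X J) (Y i)"
      using Y i by blast
    moreover obtain p where "p \<in> Y i"
      using Y i by blast
    ultimately obtain W where "finite {j \<in> J. W j \<noteq> topspace (X j)}"
      and W: "\<forall>j\<in>J. openin (X j) (W j)" "p \<in> Pi\<^sub>E J W" "Pi\<^sub>E J W \<subseteq> Y i"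
      by (rule openin_product_topology_boxE)
    moreover have "W j \<noteq> {}" if "j \<in> J" for j
      using PiE_mem[OF W(2) that] by blast
    ultimately show ?thesis
      by blast
  qed
  then obtain W where W: "\<And>i j. i \<in> I \<Longrightarrow> j \<in> J \<Longrightarrow> openin (X j) (W i j) \<and> W i j \<noteq> {}"
    and W_sub: "\<And>i. i \<in> I \<Longrightarrow> Pi\<^sub>E J (W i) \<subseteq> Y i"
    by metis
  have "\<exists>x. D_limit_point I D (X j) (\<lambda>i. W i j) x" if j: "j \<in> J" for j
    using bspec[OF pc j, unfolded D_pseudocompact_def, THEN spec, THEN mp, of "\<lambda>i. W i j"] W j
    by simp
  then obtain x where x: "\<And>j. j \<in> J \<Longrightarrow> D_limit_point I D (X j) (\<lambda>i. W i j) (x j)"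
    by metis
  have "D_limit_point I D (product_topology X J) Y (restrict x J)"
    unfolding D_limit_point_def
  proof (intro conjI allI impI)
    show "restrict x J \<in> topspace (product_topology X J)"
      using x unfolding D_limit_point_def by auto
  next
    fix U
    assume "neighbourhood (product_topology X J) (restrict x J) U"
    then obtain O' where O': "openin (product_topology X J) O'" "restrict x J \<in> O'" "O' \<subseteq> U"
      unfolding neighbourhood_def by blast
    obtain V where fin: "finite {j \<in> J. V j \<noteq> topspace (X j)}"
      and V: "\<forall>j\<in>J. openin (X j) (V j)" and xV: "restrict x J \<in> Pi\<^sub>E J V" and V_sub: "Pi\<^sub>E J V \<subseteq> O'"
      using openin_product_topology_boxE[OF O'(1,2)] .
    have "eventually (\<lambda>i. i \<in> I \<and> W i j \<inter> V j \<noteq> {}) D" if "j \<in> J" for j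
      using D_limit_pointD[OF x[OF that]] V PiE_mem[OF xV that] that by simp
    then have "eventually (\<lambda>i. \<forall>j\<in>{j \<in> J. V j \<noteq> topspace (X j)}. i \<in> I \<and> W i j \<inter> V j \<noteq> {}) D"
      by (intro eventually_ball_finite[OF fin]) blast
    with I_ev show "eventually (\<lambda>i. i \<in> {i \<in> I. Y i \<inter> U \<noteq> {}}) D"
    proof eventually_elim
      case (elim i)
      have "W i j \<inter> V j \<noteq> {}" if j: "j \<in> J" for j
      proof (cases "V j = topspace (X j)")
        case True
        then show ?thesis
          using W[OF elim(1) j] openin_subset by fastforce
      next
        case False
        then show ?thesis
          using elim(2) j by blast
      qed
      then have "Pi\<^sub>E J (W i) \<inter> Pi\<^sub>E J V \<noteq> {}"
        by (simp add: PiE_Int PiE_eq_empty_iff)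
      then show ?case
        using W_sub[OF elim(1)] V_sub O'(3) elim(1) by blast
    qed
  qed
  then show "\<exists>x. D_limit_point I D (product_topology X J) Y x"
    by blast
qed

theorem corollary3p7:
  fixes \<Lambda> :: "'l rel" and \<mu> :: "'m rel" and I :: "'i set" and D :: "'i filter"
  assumes "Card_order \<Lambda>" and "cinfinite \<Lambda>"
    and "Card_order \<mu>" and "cinfinite \<mu>"
    and "regular_ultrafilter \<mu> \<Lambda> I D"
  shows "(\<forall>X :: 'a topology. D_pseudocompact I D X \<longrightarrow> O_compact \<mu> \<Lambda> X) \<and>
    (\<forall>(J :: 'j set) (X :: 'j \<Rightarrow> 'b topology).
       (\<forall>j\<in>J. D_pseudocompact I D (X j)) \<longrightarrow> O_compact \<mu> \<Lambda> (product_topology X J))"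
proof -
  have "eventually (\<lambda>i. i \<in> I) D"
    using assms(5) unfolding regular_ultrafilter_def ultrafilter_over_def by blast
  then show ?thesis
    by (intro conjI allI impI D_pseudocompact_imp_O_compact[OF assms(5)] D_pseudocompact_product)
qed

end
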